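(* Let $(X_1,Y_1),\dots,(X_n,Y_n)$ be i.i.d. from the single-index model described in the context, with true parameter $T^\star$ and true design law $\Pi^\star$. Assume: (1) (Invertibility on the tangent space) there is $c_{\mathbb T}>0$ such that the restricted information operator $A=P_{\mathbb T}GP_{\mathbb T}$ satisfies $\langle H,AH\rangle\ge c_{\mathbb T}\|H\|_F^2$ for all $H\in\mathbb T$; (2) (Global unbiasedness) the estimator $\widehat\psi=\widehat\psi((X_i,Y_i)_{i=1}^n)$ satisfies $\mathbb E_{T,\Pi}[\widehat\psi]=\psi(T)$ for every $T$ in the parameter space $\mathcal P$. Then any such estimator $\widehat\psi$ with finite variance satisfies $$\mathrm{Var}^\star(\widehat\psi)\ \ge\ \frac1n V_{\mathrm{eff}}(\psi),\qquad V_{\mathrm{eff}}(\psi)=\big\langle P_{\mathbb T}\nabla\psi(T^\star),\,A^{-1}P_{\mathbb T}\nabla\psi(T^\star)\big\rangle .$$ Moreover the bound is attained by the efficient influence function $\phi_{\mathrm{EIF}}(X,Y)=s_\eta(Y,\eta^\star)\langle H^\star,X\rangle$, where $H^\star=A^{-1}P_{\mathbb T}\nabla\psi(T^\star)$ and $\eta^\star=\langle T^\star,X\rangle$, in the sense that $\mathbb E^\star[\phi_{\mathrm{EIF}}(X,Y)^2]=V_{\mathrm{eff}}(\psi)$.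
   Context: Model. Parameters are tensors $T\in\mathbb R^{d_1\times\cdots\times d_m}$ with the trace inner product $\langle U,V\rangle=\sum_{j_1,\dots,j_m}U_{j_1\dots j_m}V_{j_1\dots j_m}$ and norm $\|\cdot\|_F$. The design $X\in\mathbb R^{d_1\times\cdots\times d_m}$ has law $\Pi$ (a nuisance parameter; true value $\Pi^\star$), and given $X$ the response $Y\in\mathcal Y$ has conditional log-density $\ell(Y,\langle T,X\rangle)$ for a known function $\ell:\mathcal Y\times\mathbb R\to\mathbb R$. $\mathbb E_{T,\Pi}$ is expectation under $(T,\Pi)$; $\mathbb E^\star,\mathrm{Var}^\star$ are taken under $(T^\star,\Pi^\star)$. Parameter space. $\mathbb M_r$ is the low-rank manifold of tensors of (Tucker) rank at most $r$ (matrices of rank at most $r$ if $m=2$), $\mathcal C$ is a known linear operator (identification constraint), and $\mathcal P$ is the set of $T\in\mathbb M_r$ with $\mathcal C(T)=0$; $T^\star\in\mathcal P$. The signal tangent space is $\mathbb T=\mathrm{Tan}_{T^\star}(\mathbb M_r)\cap\{\Delta:\mathcal C(\Delta)=0\}$ and $P_{\mathbb T}$ is the orthogonal projection onto it. Target. $\psi:\mathbb R^{d_1\times\cdots\times d_m}\to\mathbb R$ is Gateaux differentiable at $T^\star$ with gradient $\nabla\psi(T^\star)$, so that its derivative along $H\in\mathbb T$ is $\langle\nabla\psi(T^\star),H\rangle=\langle P_{\mathbb T}\nabla\psi(T^\star),H\rangle$. Score and information. $s_\eta(y,\eta)=\partial_\eta\ell(y,\eta)$, and $I(\eta)=\mathbb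 E[s_\eta(Y,\eta)^2\mid\eta]$ is the scalar Fisher information. The information operator $G$ is defined by $\langle GU,V\rangle=\mathbb E^\star[I(\eta^\star)\langle U,X\rangle\langle V,X\rangle]$, with $\eta^\star=\langle T^\star,X\rangle$. Regularity. The model is regular: $\mathbb E^\star[s_\eta(Y,\eta^\star)\mid X]=0$; each $H\in\mathbb T$ is the direction at $\varepsilon=0$ of a one-parameter submodel $\varepsilon\mapsto T_\varepsilon$ of $\mathcal P$ with $T_0=T^\star$ (to first order $T_\varepsilon=T^\star+\varepsilon H$), design law held fixed at $\Pi^\star$, whose per-observation score at $\varepsilon=0$ is $s_\eta(Y,\eta^\star)\langle H,X\rangle$ and along which $\frac{d}{d\varepsilon}\psi(T_\varepsilon)|_{\varepsilon=0}=\langle\nabla\psi(T^\star),H\rangle$; and for finite-variance statistics $W$ of the sample the score identity $\frac{d}{d\varepsilon}\mathbb E_{T_\varepsilon,\Pi^\star}[W]\big|_{\varepsilon=0}=\mathbb E^\star\big[W\sum_{i=1}^n s_\eta(Y_i,\eta_i^\star)\langle H,X_i\rangle\big]$ holds. *)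

theory Defs
  imports "HOL-Probability.Probability"
begin

text \<open>
  A real tensor whose modes are the elements of \<open>'m\<close> and whose dimension in mode \<open>k\<close> is
  \<open>d k\<close> is a vector \<open>T :: real ^ 'c\<close>, where \<open>'c\<close> is a type of cells enumerated by
  \<open>ix :: 'c \<Rightarrow> 'm \<Rightarrow> nat\<close>: the entry \<open>T $ c\<close> is the entry with multi-index \<open>ix c\<close>.
  Under this identification the trace inner product is \<open>U \<bullet> V\<close> and the Frobenius norm
  is \<open>norm T\<close>.
\<close>

definition tensor_cells :: "('m::finite \<Rightarrow> nat) \<Rightarrow> ('c::finite \<Rightarrow> 'm \<Rightarrow> nat) \<Rightarrow> bool" where
  "tensor_cells d ix \<longleftrightarrow> bij_betw ix UNIV {j. \<forall>k. j k < d k}"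

text \<open>
  The mode-\<open>k\<close> unfolding has one row for each mode-\<open>k\<close> index and one column for each tuple
  of the remaining indices.  Here rows and columns are both labelled by cells: row \<open>a\<close> uses only
  the \<open>k\<close>-th index of \<open>a\<close>, and column \<open>b\<close> only the other indices of \<open>b\<close>.  Each row
  and column of the usual unfolding is thereby repeated, which leaves its rank unchanged.
\<close>

definition mode_unfolding ::
  "('c::finite \<Rightarrow> 'm \<Rightarrow> nat) \<Rightarrow> 'm \<Rightarrow> real ^ 'c \<Rightarrow> real ^ 'c ^ 'c" where
  "mode_unfolding ix k T = (\<chi> a b. T $ inv ix ((ix b)(k := ix a k)))"

definition low_rank :: "('c::finite \<Rightarrow> 'm \<Rightarrow> nat) \<Rightarrow> ('m \<Rightarrow> nat) \<Rightarrow> (real ^ 'c) set" where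
  "low_rank ix r = {T. \<forall>k. rank (mode_unfolding ix k T) \<le> r k}"

definition param_space ::
  "('c::finite \<Rightarrow> 'm \<Rightarrow> nat) \<Rightarrow> ('m \<Rightarrow> nat) \<Rightarrow> (real ^ 'c \<Rightarrow> 'b::real_vector) \<Rightarrow> (real ^ 'c) set" where
  "param_space ix r C = {T \<in> low_rank ix r. C T = 0}"

text \<open>
  Velocities at \<open>p\<close> of curves in \<open>M\<close>.  Where \<open>M\<close> is an embedded manifold near \<open>p\<close> they
  already form a linear subspace and \<open>span\<close> has no effect; taking the span makes the
  orthogonal projection below meaningful without assuming that \<open>p\<close> is a smooth point.
\<close>

definition tangent_space :: "'a::real_normed_vector set \<Rightarrow> 'a \<Rightarrow> 'a set" where
  "tangent_space M p =
     span {v. \<exists>\<gamma> :: real \<Rightarrow> 'a. \<gamma> 0 = p \<and> (\<forall>\<^sub>F t in nhds 0. \<gamma> t \<in> M) \<and>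
                (\<gamma> has_vector_derivative v) (at 0)}"

definition signal_tangent ::
  "('c::finite \<Rightarrow> 'm \<Rightarrow> nat) \<Rightarrow> ('m \<Rightarrow> nat) \<Rightarrow> (real ^ 'c \<Rightarrow> 'b::real_vector) \<Rightarrow> real ^ 'c
     \<Rightarrow> (real ^ 'c) set" where
  "signal_tangent ix r C T = tangent_space (low_rank ix r) T \<inter> {\<Delta>. C \<Delta> = 0}"

definition orth_proj :: "'a::euclidean_space set \<Rightarrow> 'a \<Rightarrow> 'a" where
  "orth_proj S x = (THE p. p \<in> S \<and> (\<forall>v\<in>S. (x - p) \<bullet> v = 0))"

definition gateaux_gradient :: "('a::real_inner \<Rightarrow> real) \<Rightarrow> 'a \<Rightarrow> 'a \<Rightarrow> bool" where
  "gateaux_gradient \<psi> T g \<longleftrightarrow>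
     (\<forall>H. ((\<lambda>\<epsilon>. \<psi> (T + \<epsilon> *\<^sub>R H)) has_real_derivative g \<bullet> H) (at 0))"

text \<open>
  \<open>N\<close> is the measure on the response space with respect to which
  \<open>\<lambda>y. ll y \<eta>\<close> is the log-density of the response given the index \<open>\<eta>\<close>.
\<close>

definition response_law :: "'y measure \<Rightarrow> ('y \<Rightarrow> real \<Rightarrow> real) \<Rightarrow> real \<Rightarrow> 'y measure" where
  "response_law N ll \<eta> = density N (\<lambda>y. ennreal (exp (ll y \<eta>)))"

definition single_index_model :: "'y measure \<Rightarrow> ('y \<Rightarrow> real \<Rightarrow> real) \<Rightarrow> bool" where
  "single_index_model N ll \<longleftrightarrow>
     sigma_finite_measure N \<and>
     (\<lambda>(y, \<eta>). ll y \<eta>) \<in> borel_measurable (N \<Otimes>\<^sub>M borel) \<and>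
     (\<forall>\<eta>. prob_space (response_law N ll \<eta>)) \<and>
     (\<forall>y\<in>space N. \<forall>\<eta>. (\<lambda>t. ll y t) field_differentiable at \<eta>)"

definition design_law :: "'a::topological_space measure \<Rightarrow> bool" where
  "design_law D \<longleftrightarrow> prob_space D \<and> sets D = sets borel"

definition obs_law ::
  "'y measure \<Rightarrow> ('y \<Rightarrow> real \<Rightarrow> real) \<Rightarrow> 'a::euclidean_space \<Rightarrow> 'a measure \<Rightarrow> ('a \<times> 'y) measure" where
  "obs_law N ll T D = density (D \<Otimes>\<^sub>M N) (\<lambda>(x, y). ennreal (exp (ll y (T \<bullet> x))))"

definition sample_law ::
  "nat \<Rightarrow> 'y measure \<Rightarrow> ('y \<Rightarrow> real \<Rightarrow> real) \<Rightarrow> 'a::euclidean_space \<Rightarrow> 'a measure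
     \<Rightarrow> (nat \<Rightarrow> 'a \<times> 'y) measure" where
  "sample_law n N ll T D = (\<Pi>\<^sub>M i\<in>{..<n}. obs_law N ll T D)"

definition statistics :: "nat \<Rightarrow> 'y measure \<Rightarrow> ((nat \<Rightarrow> 'a::euclidean_space \<times> 'y) \<Rightarrow> real) set" where
  "statistics n N = borel_measurable (\<Pi>\<^sub>M i\<in>{..<n}. borel \<Otimes>\<^sub>M N)"

definition finite_variance :: "'w measure \<Rightarrow> ('w \<Rightarrow> real) \<Rightarrow> bool" where
  "finite_variance M W \<longleftrightarrow> integrable M (\<lambda>\<omega>. (W \<omega>)\<^sup>2)"

definition globally_unbiased ::
  "nat \<Rightarrow> 'y measure \<Rightarrow> ('y \<Rightarrow> real \<Rightarrow> real) \<Rightarrow> 'a::euclidean_space set \<Rightarrow> 'a measure set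
     \<Rightarrow> ('a \<Rightarrow> real) \<Rightarrow> ((nat \<Rightarrow> 'a \<times> 'y) \<Rightarrow> real) \<Rightarrow> bool" where
  "globally_unbiased n N ll P Q \<psi> est \<longleftrightarrow>
     (\<forall>T\<in>P. \<forall>D\<in>Q. integrable (sample_law n N ll T D) est \<and>
        (\<integral>\<omega>. est \<omega> \<partial>sample_law n N ll T D) = \<psi> T)"

definition score :: "('y \<Rightarrow> real \<Rightarrow> real) \<Rightarrow> 'y \<Rightarrow> real \<Rightarrow> real" where
  "score ll y \<eta> = deriv (\<lambda>t. ll y t) \<eta>"

definition fisher_info :: "'y measure \<Rightarrow> ('y \<Rightarrow> real \<Rightarrow> real) \<Rightarrow> real \<Rightarrow> real" where
  "fisher_info N ll \<eta> = (\<integral>y. (score ll y \<eta>)\<^sup>2 \<partial>response_law N ll \<eta>)"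

text \<open>
  The integrability clause says that the expectation is a genuine one;
  a non-integrable function would have Bochner integral \<open>0\<close>.
\<close>

definition information_operator ::
  "'y measure \<Rightarrow> ('y \<Rightarrow> real \<Rightarrow> real) \<Rightarrow> 'a::euclidean_space \<Rightarrow> 'a measure \<Rightarrow> ('a \<Rightarrow> 'a) \<Rightarrow> bool" where
  "information_operator N ll T D G \<longleftrightarrow>
     (\<forall>U V. integrable (obs_law N ll T D)
              (\<lambda>(x, y). fisher_info N ll (T \<bullet> x) * (U \<bullet> x) * (V \<bullet> x)) \<and>
            G U \<bullet> V = (\<integral>(x, y). fisher_info N ll (T \<bullet> x) * (U \<bullet> x) * (V \<bullet> x) \<partial>obs_law N ll T D))"

definition restricted_operator :: "'a::euclidean_space set \<Rightarrow> ('a \<Rightarrow> 'a) \<Rightarrow> 'a \<Rightarrow> 'a" where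
  "restricted_operator S G = orth_proj S \<circ> G \<circ> orth_proj S"

text \<open>
  Conditionally on \<open>X = x\<close> the response has law \<open>response_law N ll (T \<bullet> x)\<close>: the score then has
  mean zero, and \<open>fisher_info\<close> at the true index is finite.
\<close>

definition centred_score ::
  "'y measure \<Rightarrow> ('y \<Rightarrow> real \<Rightarrow> real) \<Rightarrow> 'a::euclidean_space \<Rightarrow> 'a measure \<Rightarrow> bool" where
  "centred_score N ll T D \<longleftrightarrow>
     (AE x in D. integrable (response_law N ll (T \<bullet> x)) (\<lambda>y. (score ll y (T \<bullet> x))\<^sup>2) \<and>
        integrable (response_law N ll (T \<bullet> x)) (\<lambda>y. score ll y (T \<bullet> x)) \<and>
        (\<integral>y. score ll y (T \<bullet> x) \<partial>response_law N ll (T \<bullet> x)) = 0)"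

text \<open>
  \<open>\<gamma>\<close> is a submodel of \<open>P\<close> through \<open>T\<close> with direction \<open>H\<close>; \<open>g\<close> is the gradient of
  \<open>\<psi>\<close> at \<open>T\<close>.  The clause on \<open>\<psi>\<close> is not implied by Gateaux differentiability,
  since \<open>\<gamma>\<close> need not be a line.  The score identity is required only for
  those \<open>W\<close> with finite variance under the true law whose expectation exists along the submodel.
\<close>

definition regular_submodel ::
  "nat \<Rightarrow> 'y measure \<Rightarrow> ('y \<Rightarrow> real \<Rightarrow> real) \<Rightarrow> 'a::euclidean_space set \<Rightarrow> 'a measure
     \<Rightarrow> ('a \<Rightarrow> real) \<Rightarrow> 'a \<Rightarrow> 'a \<Rightarrow> 'a \<Rightarrow> (real \<Rightarrow> 'a) \<Rightarrow> bool" where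
  "regular_submodel n N ll P D \<psi> g T H \<gamma> \<longleftrightarrow>
     \<gamma> 0 = T \<and>
     (\<forall>\<^sub>F \<epsilon> in nhds 0. \<gamma> \<epsilon> \<in> P) \<and>
     (\<gamma> has_vector_derivative H) (at 0) \<and>
     (AE (x, y) in obs_law N ll T D.
        ((\<lambda>\<epsilon>. ll y (\<gamma> \<epsilon> \<bullet> x)) has_real_derivative score ll y (T \<bullet> x) * (H \<bullet> x)) (at 0)) \<and>
     ((\<lambda>\<epsilon>. \<psi> (\<gamma> \<epsilon>)) has_real_derivative g \<bullet> H) (at 0) \<and>
     (\<forall>W \<in> statistics n N.
        finite_variance (sample_law n N ll T D) W \<longrightarrow>
        (\<forall>\<^sub>F \<epsilon> in nhds 0. integrable (sample_law n N ll (\<gamma> \<epsilon>) D) W) \<longrightarrow>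
        ((\<lambda>\<epsilon>. \<integral>\<omega>. W \<omega> \<partial>sample_law n N ll (\<gamma> \<epsilon>) D) has_real_derivative
           (\<integral>\<omega>. W \<omega> * (\<Sum>i<n. score ll (snd (\<omega> i)) (T \<bullet> fst (\<omega> i)) * (H \<bullet> fst (\<omega> i)))
              \<partial>sample_law n N ll T D)) (at 0))"

text \<open>
  \<open>A\<close> maps the whole space into \<open>S\<close> and is inverted as a map on \<open>S\<close>.
\<close>

definition efficient_direction :: "'a::euclidean_space set \<Rightarrow> ('a \<Rightarrow> 'a) \<Rightarrow> 'a \<Rightarrow> 'a" where
  "efficient_direction S A g = inv_into S A (orth_proj S g)"

definition efficient_variance :: "'a::euclidean_space set \<Rightarrow> ('a \<Rightarrow> 'a) \<Rightarrow> 'a \<Rightarrow> real" where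
  "efficient_variance S A g = orth_proj S g \<bullet> inv_into S A (orth_proj S g)"

definition efficient_influence ::
  "('y \<Rightarrow> real \<Rightarrow> real) \<Rightarrow> 'a::euclidean_space \<Rightarrow> 'a \<Rightarrow> 'a \<times> 'y \<Rightarrow> real" where
  "efficient_influence ll T H = (\<lambda>(x, y). score ll y (T \<bullet> x) * (H \<bullet> x))"

end

theory Submission
  imports Defs
begin

text \<open>
  Put \<open>H\<^sup>\<star> = A\<^sup>-\<^sup>1 P\<^sub>T \<nabla>\<psi>\<close> and let \<open>S\<close> be the sample score in the direction \<open>H\<^sup>\<star>\<close>.  Since the
  estimator is unbiased along a submodel with direction \<open>H\<^sup>\<star>\<close>, the score identity says that its
  covariance with \<open>S\<close> is \<open>\<nabla>\<psi> \<bullet> H\<^sup>\<star> = V\<^sub>e\<^sub>f\<^sub>f\<close>, while \<open>S\<close> is centred with variance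
  \<open>n (H\<^sup>\<star> \<bullet> G H\<^sup>\<star>) = n V\<^sub>e\<^sub>f\<^sub>f\<close>.  Hence \<open>S / n\<close> has variance \<open>V\<^sub>e\<^sub>f\<^sub>f / n\<close> and the same covariance with the
  estimator, and the bound is the nonnegativity of the second moment of their centred difference.
\<close>

section \<open>Orthogonal projections and coercive operators on a subspace\<close>

text \<open>Two candidates for the projection differ by a vector of \<open>S\<close> that is
  orthogonal to itself, so the description defining \<open>orth_proj\<close> has at most one
  witness.\<close>

lemma orth_proj_eqI:
  assumes "subspace S" "p \<in> S" "\<And>v. v \<in> S \<Longrightarrow> (x - p) \<bullet> v = 0"
  shows "orth_proj S x = p"
  unfolding orth_proj_def
proof (rule the_equality)
  fix q assume q: "q \<in> S \<and> (\<forall>v\<in>S. (x - q) \<bullet> v = 0)"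
  have "q - p \<in> S" using q assms(1,2) by (simp add: subspace_diff)
  then have "(x - p) \<bullet> (q - p) = 0" "(x - q) \<bullet> (q - p) = 0"
    using q assms(3) by auto
  then have "(q - p) \<bullet> (q - p) = 0"
    by (simp add: inner_diff_left)
  then show "q = p" by simp
qed (use assms in auto)

text \<open>The orthogonal decomposition of the space supplies the witness; only with existence does
  the definite description in \<open>orth_proj\<close> denote the projection.\<close>

lemma orth_proj_props:
  fixes S :: "'a::euclidean_space set"
  assumes S: "subspace S"
  shows orth_proj_in: "orth_proj S x \<in> S"
    and inner_diff_orth_proj: "v \<in> S \<Longrightarrow> (x - orth_proj S x) \<bullet> v = 0"
proof -
  obtain y z where yz: "y \<in> span S" "\<And>w. w \<in> span S \<Longrightarrow> orthogonal z w" "x = y + z"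
    using orthogonal_subspace_decomp_exists[of S x] by metis
  have sp: "span S = S" using S by (rule span_eq_iff[THEN iffD2])
  have z: "(x - y) \<bullet> w = 0" if "w \<in> S" for w
    using yz that unfolding sp by (auto simp: orthogonal_def)
  have y: "y \<in> S" using yz sp by simp
  have "orth_proj S x = y" using y z by (intro orth_proj_eqI[OF S])
  then show "orth_proj S x \<in> S" "v \<in> S \<Longrightarrow> (x - orth_proj S x) \<bullet> v = 0"
    using y z by auto
qed

lemma orth_proj_id: "subspace S \<Longrightarrow> x \<in> S \<Longrightarrow> orth_proj S x = x"
  by (rule orth_proj_eqI) auto

lemma inner_orth_proj:
  fixes S :: "'a::euclidean_space set"
  assumes "subspace S" "v \<in> S"
  shows "orth_proj S x \<bullet> v = x \<bullet> v"
  using inner_diff_orth_proj[OF assms, of x] by (simp add: inner_diff_left)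

lemma linear_orth_proj:
  fixes S :: "'a::euclidean_space set"
  assumes S: "subspace S"
  shows "linear (orth_proj S)"
proof (rule linearI)
  fix x y :: 'a and c :: real
  show "orth_proj S (x + y) = orth_proj S x + orth_proj S y"
    by (rule orth_proj_eqI[OF S])
      (auto simp: subspace_add[OF S] orth_proj_in[OF S] inner_diff_left inner_add_left
        inner_orth_proj[OF S])
  show "orth_proj S (c *\<^sub>R x) = c *\<^sub>R orth_proj S x"
    by (rule orth_proj_eqI[OF S])
      (auto simp: subspace_scale[OF S] orth_proj_in[OF S] inner_diff_left inner_orth_proj[OF S])
qed

text \<open>Coercivity forces a trivial kernel on \<open>S\<close>, and an injective linear self-map
  of a finite-dimensional space is onto. This is what turns \<open>inv_into S A\<close> into a
  genuine inverse on \<open>S\<close>.\<close>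

lemma linear_coercive_image_eq:
  fixes A :: "'a::euclidean_space \<Rightarrow> 'a"
  assumes S: "subspace S" and A: "linear A" "A ` S \<subseteq> S"
    and c: "c > 0" "\<And>h. h \<in> S \<Longrightarrow> c * (norm h)\<^sup>2 \<le> h \<bullet> A h"
  shows "A ` S = S"
proof -
  have "inj_on A S"
  proof (rule inj_onI)
    fix x y assume xy: "x \<in> S" "y \<in> S" "A x = A y"
    then have "c * (norm (x - y))\<^sup>2 \<le> (x - y) \<bullet> A (x - y)"
      using c(2) S by (simp add: subspace_diff)
    also have "A (x - y) = 0" using xy A(1) by (simp add: linear_diff)
    finally have "(norm (x - y))\<^sup>2 \<le> 0" using c(1) by (simp add: mult_le_0_iff)
    then show "x = y" by simp
  qed
  then have "dim (A ` S) = dim S"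
    by (intro dim_image_eq A(1)) (use S in \<open>simp add: span_eq_iff[THEN iffD2]\<close>)
  then show ?thesis
    using A S by (intro subspace_dim_equal linear_subspace_image) auto
qed

text \<open>The \<open>span\<close> in \<open>tangent_space\<close> makes this hold at singular
  points of the low-rank set as well.\<close>

lemma subspace_signal_tangent:
  assumes "linear C"
  shows "subspace (signal_tangent ix r C T)"
  unfolding signal_tangent_def tangent_space_def
  by (intro subspace_inter subspace_span linear_subspace_kernel assms)

section \<open>Square-integrable functions and sums of i.i.d. terms\<close>

lemma integrable_mult_square_integrable:
  fixes f g :: "'a \<Rightarrow> real"
  assumes [measurable]: "f \<in> borel_measurable M" "g \<in> borel_measurable M"
    and "integrable M (\<lambda>x. (f x)\<^sup>2)" "integrable M (\<lambda>x. (g x)\<^sup>2)"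
  shows "integrable M (\<lambda>x. f x * g x)"
proof (rule Bochner_Integration.integrable_bound)
  show "integrable M (\<lambda>x. (f x)\<^sup>2 + (g x)\<^sup>2)" using assms by simp
  have "\<bar>a * b\<bar> \<le> a\<^sup>2 + b\<^sup>2" for a b :: real
    using sum_squares_bound[of "\<bar>a\<bar>" "\<bar>b\<bar>"] abs_ge_zero[of "a * b"]
    unfolding abs_mult power2_abs by linarith
  then show "AE x in M. norm (f x * g x) \<le> norm ((f x)\<^sup>2 + (g x)\<^sup>2)"
    by simp
qed simp

text \<open>When the square of the sum is expanded, each off-diagonal term is a product of two
  independent centred factors and integrates to zero. The \<open>card I\<close> diagonal terms
  remain.\<close>

lemma second_moment_iid_sum:
  fixes f :: "'a \<Rightarrow> real" and I :: "'i set"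
  assumes M: "prob_space M" and I: "finite I"
    and f[measurable]: "f \<in> borel_measurable M"
    and sq: "integrable M (\<lambda>x. (f x)\<^sup>2)" and mean: "(\<integral>x. f x \<partial>M) = 0"
  defines "PM \<equiv> (\<Pi>\<^sub>M i\<in>I. M)"
  shows "integrable PM (\<lambda>\<omega>. (\<Sum>i\<in>I. f (\<omega> i))\<^sup>2)"
    and "(\<integral>\<omega>. (\<Sum>i\<in>I. f (\<omega> i))\<^sup>2 \<partial>PM) = real (card I) * (\<integral>x. (f x)\<^sup>2 \<partial>M)"
    and "integrable PM (\<lambda>\<omega>. \<Sum>i\<in>I. f (\<omega> i))"
    and "(\<integral>\<omega>. (\<Sum>i\<in>I. f (\<omega> i)) \<partial>PM) = 0"
proof -
  interpret M: prob_space M by (rule M)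
  have pm: "product_sigma_finite (\<lambda>_::'i. M)"
    unfolding product_sigma_finite_def using M.sigma_finite_measure_axioms by blast
  have int: "integrable M f"
    by (rule M.square_integrable_imp_integrable[OF f sq])
  \<comment> \<open>Each coordinate projection pushes the product measure forward to
    \<open>M\<close>, so a function of one coordinate keeps its integral.\<close>
  have *: "integrable PM (\<lambda>\<omega>. g (\<omega> i)) \<and> (\<integral>\<omega>. g (\<omega> i) \<partial>PM) = (\<integral>x. g x \<partial>M)"
    if "i \<in> I" "integrable M g" for i and g :: "'a \<Rightarrow> real"
  proof -
    have d: "distr PM M (\<lambda>\<omega>. \<omega> i) = M"
      unfolding PM_def by (rule distr_PiM_component) (auto intro: M that)
    have [measurable]: "(\<lambda>\<omega>. \<omega> i) \<in> PM \<rightarrow>\<^sub>M M"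
      unfolding PM_def by (rule measurable_component_singleton[OF that(1)])
    have [measurable]: "g \<in> borel_measurable M" using that(2) by auto
    show ?thesis
      using that integrable_distr_eq[of "\<lambda>\<omega>. \<omega> i" PM M g] integral_distr[of "\<lambda>\<omega>. \<omega> i" PM M g]
      unfolding d by simp
  qed
  have cross: "integrable PM (\<lambda>\<omega>. f (\<omega> i) * f (\<omega> j)) \<and>
      (\<integral>\<omega>. f (\<omega> i) * f (\<omega> j) \<partial>PM) = (if i = j then (\<integral>x. (f x)\<^sup>2 \<partial>M) else 0)"
    if ij: "i \<in> I" "j \<in> I" for i j
  proof (cases "i = j")
    case True
    then show ?thesis using *[OF ij(1) sq] by (simp add: power2_eq_square)
  next
    case False
    \<comment> \<open>Padding with the constant 1 writes the product of two factors as a product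
      over all of \<open>I\<close>, the form in which the product measure factorises. The factor at
      \<open>i\<close> then has integral zero.\<close>
    define h where "h k x = (if k \<in> {i, j} then f x else 1)" for k x
    have h: "integrable M (h k)" for k
      using int by (cases "k \<in> {i, j}") (auto simp: h_def[abs_def])
    have "(\<Prod>k\<in>I. h k (\<omega> k)) = (\<Prod>k\<in>{i, j}. f (\<omega> k))" for \<omega>
      by (rule prod.mono_neutral_cong_right) (use I ij in \<open>auto simp: h_def\<close>)
    then have eq: "(\<Prod>k\<in>I. h k (\<omega> k)) = f (\<omega> i) * f (\<omega> j)" for \<omega>
      using False by simp
    have "(\<Prod>k\<in>I. integral\<^sup>L M (h k)) = 0"
      using I ij mean by (intro prod_zero bexI[of _ i]) (auto simp: h_def[abs_def])
    then show ?thesis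
      using product_sigma_finite.product_integrable_prod[OF pm I, of h]
        product_sigma_finite.product_integral_prod[OF pm I, of h] h False
      unfolding eq PM_def by simp
  qed
  have sq_eq: "(\<Sum>i\<in>I. f (\<omega> i))\<^sup>2 = (\<Sum>i\<in>I. \<Sum>j\<in>I. f (\<omega> i) * f (\<omega> j))" for \<omega>
    by (simp add: power2_eq_square sum_product)
  show "integrable PM (\<lambda>\<omega>. (\<Sum>i\<in>I. f (\<omega> i))\<^sup>2)"
    unfolding sq_eq using cross by (intro Bochner_Integration.integrable_sum) auto
  have "(\<integral>\<omega>. (\<Sum>i\<in>I. f (\<omega> i))\<^sup>2 \<partial>PM)
      = (\<Sum>i\<in>I. \<Sum>j\<in>I. \<integral>\<omega>. f (\<omega> i) * f (\<omega> j) \<partial>PM)"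
    unfolding sq_eq using cross
    by (simp add: Bochner_Integration.integral_sum)
  also have "\<dots> = (\<Sum>i\<in>I. \<Sum>j\<in>I. if i = j then (\<integral>x. (f x)\<^sup>2 \<partial>M) else 0)"
    using cross by (intro sum.cong refl) auto
  also have "\<dots> = real (card I) * (\<integral>x. (f x)\<^sup>2 \<partial>M)"
    using I by simp
  finally show "(\<integral>\<omega>. (\<Sum>i\<in>I. f (\<omega> i))\<^sup>2 \<partial>PM) = real (card I) * (\<integral>x. (f x)\<^sup>2 \<partial>M)" .
  show "integrable PM (\<lambda>\<omega>. \<Sum>i\<in>I. f (\<omega> i))"
    using *[OF _ int] by (intro Bochner_Integration.integrable_sum) auto
  show "(\<integral>\<omega>. (\<Sum>i\<in>I. f (\<omega> i)) \<partial>PM) = 0"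
    using *[OF _ int] mean by (subst Bochner_Integration.integral_sum) auto
qed

section \<open>Measurability of the score and linearity of the information operator\<close>

text \<open>The derivative is the pointwise limit of the difference quotients with steps 1/(i+1),
  each of which is jointly measurable.\<close>

lemma measurable_score:
  assumes "single_index_model N ll"
  shows "(\<lambda>(y, \<eta>). score ll y \<eta>) \<in> borel_measurable (N \<Otimes>\<^sub>M borel)"
proof (rule borel_measurable_LIMSEQ_real)
  have [measurable]: "(\<lambda>(y, \<eta>). ll y \<eta>) \<in> borel_measurable (N \<Otimes>\<^sub>M borel)"
    using assms by (simp add: single_index_model_def)
  show "(\<lambda>(y, \<eta>). (ll y (\<eta> + inverse (real (Suc i))) - ll y \<eta>) / inverse (real (Suc i)))
      \<in> borel_measurable (N \<Otimes>\<^sub>M borel)" for i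
    by measurable
  fix z assume "z \<in> space (N \<Otimes>\<^sub>M (borel :: real measure))"
  then obtain y \<eta> where z: "z = (y, \<eta>)" "y \<in> space N"
    by (auto simp: space_pair_measure)
  have "((\<lambda>t. ll y t) has_real_derivative score ll y \<eta>) (at \<eta>)"
    using assms z(2) unfolding single_index_model_def score_def
    by (simp add: DERIV_deriv_iff_field_differentiable)
  then have "((\<lambda>h. (ll y (\<eta> + h) - ll y \<eta>) / h) \<longlongrightarrow> score ll y \<eta>) (at 0)"
    by (simp add: DERIV_def)
  moreover have "filterlim (\<lambda>i. inverse (real (Suc i))) (at 0) sequentially"
    using LIMSEQ_inverse_real_of_nat by (auto simp: filterlim_at)
  ultimately have "(\<lambda>i. (ll y (\<eta> + inverse (real (Suc i))) - ll y \<eta>) / inverse (real (Suc i)))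
      \<longlonglongrightarrow> score ll y \<eta>"
    by (rule filterlim_compose)
  then show "(\<lambda>i. (\<lambda>(y, \<eta>). (ll y (\<eta> + inverse (real (Suc i))) - ll y \<eta>)
      / inverse (real (Suc i))) z) \<longlonglongrightarrow> (\<lambda>(y, \<eta>). score ll y \<eta>) z"
    by (simp add: z)
qed

text \<open>The defining expectation is linear in \<open>U\<close>, its integrability clause
  allowing sums to be split, and a vector is determined by its inner products with all
  \<open>V\<close>.\<close>

lemma linear_information_operator:
  fixes N :: "'y measure" and T :: "'a::euclidean_space"
  assumes information: "information_operator N ll T D G"
  shows "linear G"
proof (rule linearI)
  fix U U' :: 'a and c :: real
  let ?f = "\<lambda>U V (x, y::'y). fisher_info N ll (T \<bullet> x) * (U \<bullet> x) * (V \<bullet> x)"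
  have int: "integrable (obs_law N ll T D) (?f U V)"
    and G: "G U \<bullet> V = (\<integral>z. ?f U V z \<partial>obs_law N ll T D)" for U V
    using information unfolding information_operator_def by auto
  have "G (U + U') \<bullet> V = (G U + G U') \<bullet> V" for V
  proof -
    have "?f (U + U') V = (\<lambda>z. ?f U V z + ?f U' V z)"
      by (auto simp: algebra_simps)
    then show ?thesis
      using int by (simp add: G inner_add_left)
  qed
  then show "G (U + U') = G U + G U'" by (metis vector_eq_rdot)
  have "G (c *\<^sub>R U) \<bullet> V = (c *\<^sub>R G U) \<bullet> V" for V
  proof -
    have "?f (c *\<^sub>R U) V = (\<lambda>z. c * ?f U V z)"
      by (auto simp: algebra_simps)
    then show ?thesis
      using int by (simp add: G)
  qed
  then show "G (c *\<^sub>R U) = c *\<^sub>R G U" by (metis vector_eq_rdot)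
qed

section \<open>The law of one observation and the moments of its score\<close>

context
  fixes N :: "'y measure" and ll :: "'y \<Rightarrow> real \<Rightarrow> real"
    and T :: "'a::euclidean_space" and D :: "'a measure"
  assumes model: "single_index_model N ll" and design: "design_law D"
begin

lemma sets_design: "sets D = sets borel"
  using design by (simp add: design_law_def)

lemma measurable_log_density [measurable]:
  "(\<lambda>(y, \<eta>). ll y \<eta>) \<in> borel_measurable (N \<Otimes>\<^sub>M borel)"
  using model by (simp add: single_index_model_def)

text \<open>For arbitrary \<open>H\<close>, \<open>efficient_influence ll T H\<close> is the score
  of one observation in direction \<open>H\<close>; it is the efficient influence function only when
  \<open>H\<close> is the efficient direction.\<close>

lemma measurable_obs_score:
  "efficient_influence ll T H \<in> borel_measurable (D \<Otimes>\<^sub>M N)"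
proof -
  note sets_design[measurable_cong] measurable_score[OF model, measurable]
  show ?thesis unfolding efficient_influence_def by measurable
qed

lemma sigma_finite_response: "sigma_finite_measure N"
  using model by (simp add: single_index_model_def)

lemma prob_space_response: "prob_space (response_law N ll \<eta>)"
  using model by (simp add: single_index_model_def)

lemma prob_space_design: "prob_space D"
  using design by (simp add: design_law_def)

lemma measurable_log_density_section: "(\<lambda>y. ll y \<eta>) \<in> borel_measurable N"
  using measurable_compose[OF measurable_Pair2' measurable_log_density, of \<eta>] by simp

lemma sets_obs_law: "sets (obs_law N ll T D) = sets (borel \<Otimes>\<^sub>M N)"
  unfolding obs_law_def using sets_design by (simp cong: sets_pair_measure_cong)

text \<open>By Tonelli the density can be absorbed into the inner integral: an observation is a
  design drawn from \<open>D\<close>, followed by a response drawn from its conditional law.\<close>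

lemma nn_integral_obs_law:
  assumes f[measurable]: "f \<in> borel_measurable (D \<Otimes>\<^sub>M N)"
  shows "(\<integral>\<^sup>+z. f z \<partial>obs_law N ll T D)
    = (\<integral>\<^sup>+x. (\<integral>\<^sup>+y. f (x, y) \<partial>response_law N ll (T \<bullet> x)) \<partial>D)"
proof -
  note sets_design[measurable_cong]
  interpret sigma_finite_measure N by (rule sigma_finite_response)
  have "(\<integral>\<^sup>+z. f z \<partial>obs_law N ll T D)
      = (\<integral>\<^sup>+z. (case z of (x, y) \<Rightarrow> ennreal (exp (ll y (T \<bullet> x)))) * f z \<partial>(D \<Otimes>\<^sub>M N))"
    unfolding obs_law_def by (rule nn_integral_density) measurable
  also have "\<dots> = (\<integral>\<^sup>+x. (\<integral>\<^sup>+y. ennreal (exp (ll y (T \<bullet> x))) * f (x, y) \<partial>N) \<partial>D)"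
    by (subst nn_integral_fst[symmetric]) simp_all
  also have "\<dots> = (\<integral>\<^sup>+x. (\<integral>\<^sup>+y. f (x, y) \<partial>response_law N ll (T \<bullet> x)) \<partial>D)"
    unfolding response_law_def
    by (intro nn_integral_cong nn_integral_density[symmetric])
      (auto intro!: measurable_compose[OF measurable_log_density_section]
        measurable_compose[OF measurable_Pair1' f])
  finally show ?thesis .
qed

lemma prob_space_obs_law: "prob_space (obs_law N ll T D)"
proof
  interpret D: prob_space D by (rule prob_space_design)
  have "emeasure (obs_law N ll T D) (space (obs_law N ll T D))
      = (\<integral>\<^sup>+x. emeasure (response_law N ll (T \<bullet> x)) (space (response_law N ll (T \<bullet> x))) \<partial>D)"
    using nn_integral_obs_law[of "\<lambda>_. 1"] by simp
  also have "\<dots> = 1"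
    by (simp add: prob_space.emeasure_space_1[OF prob_space_response] D.emeasure_space_1)
  finally show "emeasure (obs_law N ll T D) (space (obs_law N ll T D)) = 1" .
qed

text \<open>The same disintegration for real-valued functions, now by Fubini, whence the
  integrability assumption.\<close>

lemma integral_obs_law_fst:
  fixes h :: "'a \<times> 'y \<Rightarrow> real"
  assumes h: "integrable (obs_law N ll T D) h"
  shows "(\<integral>z. h z \<partial>obs_law N ll T D)
    = (\<integral>x. (\<integral>y. h (x, y) \<partial>response_law N ll (T \<bullet> x)) \<partial>D)"
proof -
  note sets_design[measurable_cong]
  interpret D: prob_space D by (rule prob_space_design)
  interpret N: sigma_finite_measure N by (rule sigma_finite_response)
  interpret pair_sigma_finite D N ..
  have hm[measurable]: "h \<in> borel_measurable (D \<Otimes>\<^sub>M N)"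
    using borel_measurable_integrable[OF h] by (simp add: obs_law_def)
  have dens: "obs_law N ll T D
      = density (D \<Otimes>\<^sub>M N) (\<lambda>z. ennreal (case z of (x, y) \<Rightarrow> exp (ll y (T \<bullet> x))))"
    unfolding obs_law_def by (simp add: case_prod_unfold)
  have int: "integrable (D \<Otimes>\<^sub>M N) (\<lambda>z. (case z of (x, y) \<Rightarrow> exp (ll y (T \<bullet> x))) *\<^sub>R h z)"
    using h unfolding dens by (subst (asm) integrable_density) (auto simp: case_prod_beta)
  have "(\<integral>z. h z \<partial>obs_law N ll T D)
      = (\<integral>z. (case z of (x, y) \<Rightarrow> exp (ll y (T \<bullet> x))) *\<^sub>R h z \<partial>(D \<Otimes>\<^sub>M N))"
    unfolding dens by (rule integral_density) (auto simp: case_prod_beta)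
  also have "\<dots> = (\<integral>x. (\<integral>y. exp (ll y (T \<bullet> x)) *\<^sub>R h (x, y) \<partial>N) \<partial>D)"
    using integral_fst'[OF int] by simp
  also have "\<dots> = (\<integral>x. (\<integral>y. h (x, y) \<partial>response_law N ll (T \<bullet> x)) \<partial>D)"
    unfolding response_law_def
    by (intro Bochner_Integration.integral_cong refl integral_density[symmetric])
      (auto intro!: measurable_compose[OF measurable_log_density_section]
        measurable_compose[OF measurable_Pair1' hm])
  finally show ?thesis .
qed

text \<open>The measure in \<open>fisher_info\<close> varies with the index. Moving its density into
  the integrand leaves a parametric integral over the fixed measure \<open>N\<close>, which is
  measurable in the parameter.\<close>

lemma measurable_fisher_info: "fisher_info N ll \<in> borel_measurable borel"
proof -
  interpret sigma_finite_measure N by (rule sigma_finite_response)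
  note measurable_score[OF model, measurable]
  have sec: "(\<lambda>y. score ll y \<eta>) \<in> borel_measurable N" for \<eta>
    using measurable_compose[OF measurable_Pair2' measurable_score[OF model], of \<eta>] by simp
  have "fisher_info N ll \<eta> = (\<integral>y. exp (ll y \<eta>) *\<^sub>R (score ll y \<eta>)\<^sup>2 \<partial>N)" for \<eta>
    unfolding fisher_info_def response_law_def
    by (rule integral_density) (use sec[of \<eta>] measurable_log_density_section[of \<eta>] in auto)
  moreover have "(\<lambda>\<eta>. (\<integral>y. exp (ll y \<eta>) *\<^sub>R (score ll y \<eta>)\<^sup>2 \<partial>N)) \<in> borel_measurable borel"
    by measurable
  ultimately show ?thesis by (simp cong: measurable_cong)
qed

text \<open>Given \<open>X = x\<close>, the score has mean zero and second moment
  \<open>fisher_info N ll (T \<bullet> x) * (H \<bullet> x)\<^sup>2\<close>; averaging over the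
  design gives the quadratic form of \<open>G\<close>. Nonnegative integrals come first because
  integrability of the squared score is itself to be derived.\<close>

lemma score_moments:
  assumes information: "information_operator N ll T D G" and centred: "centred_score N ll T D"
  shows "integrable (obs_law N ll T D) (\<lambda>z. (efficient_influence ll T H z)\<^sup>2)"
    and "(\<integral>z. (efficient_influence ll T H z)\<^sup>2 \<partial>obs_law N ll T D) = H \<bullet> G H"
    and "(\<integral>z. efficient_influence ll T H z \<partial>obs_law N ll T D) = 0"
proof -
  note sets_design[measurable_cong] measurable_obs_score[measurable] measurable_fisher_info[measurable]
  interpret D: prob_space D by (rule prob_space_design)
  interpret O: prob_space "obs_law N ll T D" by (rule prob_space_obs_law)
  let ?s = "efficient_influence ll T H"
  let ?I = "\<lambda>(x, y::'y). fisher_info N ll (T \<bullet> x) * (H \<bullet> x) * (H \<bullet> x)"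
  have I_int: "integrable (obs_law N ll T D) ?I"
    and I_eq: "(\<integral>z. ?I z \<partial>obs_law N ll T D) = H \<bullet> G H"
    using information unfolding information_operator_def inner_commute[of H "G H"] by auto
  have I_nonneg: "0 \<le> ?I z" for z
    by (cases z) (simp add: fisher_info_def mult.assoc)
  have inner_int: "AE x in D. (\<integral>\<^sup>+y. ennreal ((?s (x, y))\<^sup>2) \<partial>response_law N ll (T \<bullet> x))
      = (\<integral>\<^sup>+y. ennreal (?I (x, y)) \<partial>response_law N ll (T \<bullet> x))"
    using centred unfolding centred_score_def
  proof eventually_elim
    case (elim x)
    interpret R: prob_space "response_law N ll (T \<bullet> x)" by (rule prob_space_response)
    have "(\<integral>\<^sup>+y. ennreal ((?s (x, y))\<^sup>2) \<partial>response_law N ll (T \<bullet> x))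
        = ennreal (\<integral>y. (?s (x, y))\<^sup>2 \<partial>response_law N ll (T \<bullet> x))"
      using elim by (intro nn_integral_eq_integral)
        (auto simp: efficient_influence_def power_mult_distrib)
    \<comment> \<open>\<open>?I\<close> does not depend on the response, so \<open>undefined\<close>
      can stand for it; the constant then equals its own integral under the conditional probability
      law.\<close>
    also have "(\<integral>y. (?s (x, y))\<^sup>2 \<partial>response_law N ll (T \<bullet> x)) = ?I (x, undefined)"
      by (simp add: efficient_influence_def power_mult_distrib fisher_info_def mult.assoc
          flip: power2_eq_square)
    finally show ?case
      by (simp add: R.emeasure_space_1)
  qed
  have "(\<integral>\<^sup>+z. ennreal ((?s z)\<^sup>2) \<partial>obs_law N ll T D)
      = (\<integral>\<^sup>+x. (\<integral>\<^sup>+y. ennreal ((?s (x, y))\<^sup>2) \<partial>response_law N ll (T \<bullet> x)) \<partial>D)"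
    by (rule nn_integral_obs_law) measurable
  also have "\<dots> = (\<integral>\<^sup>+x. (\<integral>\<^sup>+y. ennreal (?I (x, y)) \<partial>response_law N ll (T \<bullet> x)) \<partial>D)"
    by (rule nn_integral_cong_AE[OF inner_int])
  also have "\<dots> = (\<integral>\<^sup>+z. ennreal (?I z) \<partial>obs_law N ll T D)"
    by (rule nn_integral_obs_law[symmetric]) measurable
  also have "\<dots> = ennreal (H \<bullet> G H)"
    using nn_integral_eq_integral[OF I_int] I_nonneg I_eq by simp
  finally have nn: "(\<integral>\<^sup>+z. ennreal ((?s z)\<^sup>2) \<partial>obs_law N ll T D) = ennreal (H \<bullet> G H)" .
  have G_nonneg: "0 \<le> H \<bullet> G H"
    unfolding I_eq[symmetric] by (intro Bochner_Integration.integral_nonneg I_nonneg)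
  have s_meas: "?s \<in> borel_measurable (obs_law N ll T D)"
    using measurable_obs_score by (simp add: obs_law_def)
  \<comment> \<open>A finite nonnegative integral yields integrability together with the
    value.\<close>
  have "has_bochner_integral (obs_law N ll T D) (\<lambda>z. (?s z)\<^sup>2) (H \<bullet> G H)"
    using nn G_nonneg s_meas by (intro has_bochner_integral_nn_integral) auto
  then show sq: "integrable (obs_law N ll T D) (\<lambda>z. (?s z)\<^sup>2)"
    and "(\<integral>z. (?s z)\<^sup>2 \<partial>obs_law N ll T D) = H \<bullet> G H"
    by (auto simp: has_bochner_integral_iff)
  have "integrable (obs_law N ll T D) ?s"
    using O.square_integrable_imp_integrable[OF s_meas sq] .
  then have "(\<integral>z. ?s z \<partial>obs_law N ll T D)
      = (\<integral>x. (\<integral>y. ?s (x, y) \<partial>response_law N ll (T \<bullet> x)) \<partial>D)"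
    by (rule integral_obs_law_fst)
  also have "\<dots> = 0"
  proof (rule integral_eq_zero_AE)
    show "AE x in D. (\<integral>y. ?s (x, y) \<partial>response_law N ll (T \<bullet> x)) = 0"
      using centred unfolding centred_score_def
      by eventually_elim (simp add: efficient_influence_def)
  qed
  finally show "(\<integral>z. ?s z \<partial>obs_law N ll T D) = 0" .
qed

end

section \<open>The efficient direction and the variance bound\<close>

text \<open>Since \<open>H\<close> lies in \<open>S\<close>, projecting the other argument does not
  change an inner product with \<open>H\<close>. With \<open>A H = orth_proj S g\<close>, both
  \<open>g \<bullet> H\<close> and \<open>G H \<bullet> H\<close> therefore reduce to
  \<open>orth_proj S g \<bullet> H\<close>.\<close>

lemma efficient_direction_props:
  fixes S :: "'a::euclidean_space set" and g :: 'a
  assumes S: "subspace S" and G: "linear G"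
    and c: "c > 0" "\<forall>H\<in>S. c * (norm H)\<^sup>2 \<le> H \<bullet> restricted_operator S G H"
  defines "H \<equiv> efficient_direction S (restricted_operator S G) g"
    and "V \<equiv> efficient_variance S (restricted_operator S G) g"
  shows "H \<in> S" "g \<bullet> H = V" "H \<bullet> G H = V"
proof -
  let ?A = "restricted_operator S G"
  have "linear ?A"
    unfolding restricted_operator_def
    by (intro linear_compose G linear_orth_proj S)
  moreover have "?A ` S \<subseteq> S"
    by (auto simp: restricted_operator_def orth_proj_in[OF S])
  ultimately have "?A ` S = S"
    using c by (intro linear_coercive_image_eq[OF S]) auto
  then have im: "orth_proj S g \<in> ?A ` S"
    by (simp add: orth_proj_in[OF S])
  show H: "H \<in> S"
    unfolding H_def efficient_direction_def by (rule inv_into_into[OF im])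
  have AH: "?A H = orth_proj S g"
    unfolding H_def efficient_direction_def by (rule f_inv_into_f[OF im])
  have V: "V = orth_proj S g \<bullet> H"
    unfolding V_def H_def efficient_variance_def efficient_direction_def ..
  then show "g \<bullet> H = V" by (simp add: inner_orth_proj[OF S H])
  have "V = orth_proj S (G H) \<bullet> H"
    unfolding V AH[symmetric] by (simp add: restricted_operator_def orth_proj_id[OF S H])
  then show "H \<bullet> G H = V" by (simp add: inner_orth_proj[OF S H] inner_commute[of H])
qed

text \<open>Near zero the expectation of the estimator along the submodel is
  \<open>\<psi> (\<gamma> \<epsilon>)\<close>. The score identity and the clause on
  \<open>\<psi>\<close> each give its derivative at zero, and derivatives are unique.\<close>

lemma unbiased_score_covariance:
  assumes sub: "regular_submodel n N ll P D \<psi> g T H \<gamma>"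
    and D: "D \<in> Q"
    and est: "est \<in> statistics n N" "globally_unbiased n N ll P Q \<psi> est"
      "finite_variance (sample_law n N ll T D) est"
  shows "(\<integral>\<omega>. est \<omega> * (\<Sum>i<n. efficient_influence ll T H (\<omega> i)) \<partial>sample_law n N ll T D) = g \<bullet> H"
proof -
  have unb: "integrable (sample_law n N ll T' D) est"
    "(\<integral>\<omega>. est \<omega> \<partial>sample_law n N ll T' D) = \<psi> T'" if "T' \<in> P" for T'
    using est(2) D that by (auto simp: globally_unbiased_def)
  have ev: "\<forall>\<^sub>F \<epsilon> in nhds 0. \<gamma> \<epsilon> \<in> P"
    and der: "((\<lambda>\<epsilon>. \<psi> (\<gamma> \<epsilon>)) has_real_derivative g \<bullet> H) (at 0)"
    using sub by (auto simp: regular_submodel_def)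
  \<comment> \<open>Unbiasedness includes existence of the expectation, which discharges the
    integrability premise of the score identity.\<close>
  have "\<forall>\<^sub>F \<epsilon> in nhds 0. integrable (sample_law n N ll (\<gamma> \<epsilon>) D) est"
    using ev by eventually_elim (rule unb)
  then have "((\<lambda>\<epsilon>. \<integral>\<omega>. est \<omega> \<partial>sample_law n N ll (\<gamma> \<epsilon>) D) has_real_derivative
      (\<integral>\<omega>. est \<omega> * (\<Sum>i<n. score ll (snd (\<omega> i)) (T \<bullet> fst (\<omega> i)) * (H \<bullet> fst (\<omega> i)))
         \<partial>sample_law n N ll T D)) (at 0)"
    using sub est unfolding regular_submodel_def by blast
  moreover have "((\<lambda>\<epsilon>. \<integral>\<omega>. est \<omega> \<partial>sample_law n N ll (\<gamma> \<epsilon>) D) has_real_derivative g \<bullet> H) (at 0)"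
  proof (rule DERIV_cong_ev[THEN iffD1, OF refl _ refl der])
    show "\<forall>\<^sub>F \<epsilon> in nhds 0. \<psi> (\<gamma> \<epsilon>) = (\<integral>\<omega>. est \<omega> \<partial>sample_law n N ll (\<gamma> \<epsilon>) D)"
      using ev by eventually_elim (simp add: unb)
  qed
  ultimately show ?thesis
    unfolding efficient_influence_def case_prod_beta by (rule DERIV_unique)
qed

theorem theorem3p5:
  fixes d r :: "'m::finite \<Rightarrow> nat"
    and ix :: "'c::finite \<Rightarrow> 'm \<Rightarrow> nat"
    and C :: "real ^ 'c \<Rightarrow> 'b::real_vector"
    and N :: "'y measure"
    and ll :: "'y \<Rightarrow> real \<Rightarrow> real"
    and Q :: "(real ^ 'c) measure set"
    and Tst gr :: "real ^ 'c"
    and Pist :: "(real ^ 'c) measure"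
    and \<psi> :: "real ^ 'c \<Rightarrow> real"
    and G A :: "real ^ 'c \<Rightarrow> real ^ 'c"
    and P TT :: "(real ^ 'c) set"
    and n :: nat
    and cT :: real
  defines "P \<equiv> param_space ix r C"
    and "TT \<equiv> signal_tangent ix r C Tst"
    and "A \<equiv> restricted_operator TT G"
  assumes cells: "tensor_cells d ix"
    and constraint: "linear C"
    and model: "single_index_model N ll"
    and designs: "\<forall>D\<in>Q. design_law D"
    and truth: "Tst \<in> P" "Pist \<in> Q"
    and sample_size: "n \<ge> 1"
    and gradient: "gateaux_gradient \<psi> Tst gr"
    and information: "information_operator N ll Tst Pist G"
    and score_mean: "centred_score N ll Tst Pist"
    and submodels: "\<forall>H\<in>TT. \<exists>\<gamma>. regular_submodel n N ll P Pist \<psi> gr Tst H \<gamma>"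
    and coercive: "cT > 0" "\<forall>H\<in>TT. H \<bullet> A H \<ge> cT * (norm H)\<^sup>2"
  shows "(\<forall>est \<in> statistics n N.
            globally_unbiased n N ll P Q \<psi> est \<longrightarrow>
            finite_variance (sample_law n N ll Tst Pist) est \<longrightarrow>
            prob_space.variance (sample_law n N ll Tst Pist) est
              \<ge> 1 / real n * efficient_variance TT A gr) \<and>
         integrable (obs_law N ll Tst Pist)
           (\<lambda>z. (efficient_influence ll Tst (efficient_direction TT A gr) z)\<^sup>2) \<and>
         (\<integral>z. (efficient_influence ll Tst (efficient_direction TT A gr) z)\<^sup>2
            \<partial>obs_law N ll Tst Pist) = efficient_variance TT A gr"
proof -
  define H where "H = efficient_direction TT A gr"
  define V where "V = efficient_variance TT A gr"
  have design: "design_law Pist" using designs truth(2) by blast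
  note lin = linear_information_operator[OF information]
  have TT: "subspace TT" unfolding TT_def by (rule subspace_signal_tangent[OF constraint])
  have H: "H \<in> TT" "gr \<bullet> H = V" "H \<bullet> G H = V"
    using efficient_direction_props[OF TT lin coercive(1)] coercive(2)
    unfolding H_def V_def A_def by auto
  note mom = score_moments[OF model design information score_mean, of H]
  let ?f = "efficient_influence ll Tst H" and ?L = "sample_law n N ll Tst Pist"
  interpret O: prob_space "obs_law N ll Tst Pist"
    by (rule prob_space_obs_law[OF model design])
  have f_meas: "?f \<in> borel_measurable (obs_law N ll Tst Pist)"
    using measurable_obs_score[OF model design] by (simp add: obs_law_def)
  interpret L: prob_space ?L
    unfolding sample_law_def by (rule prob_space_PiM) unfold_locales
  define S where "S \<omega> = (\<Sum>i<n. ?f (\<omega> i))" for \<omega>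
  have S_meas[measurable]: "S \<in> borel_measurable ?L"
    unfolding S_def sample_law_def using f_meas by measurable
  have S_sq: "integrable ?L (\<lambda>\<omega>. (S \<omega>)\<^sup>2)" and S_var: "(\<integral>\<omega>. (S \<omega>)\<^sup>2 \<partial>?L) = real n * V"
    and S_int: "integrable ?L S" and S_mean: "(\<integral>\<omega>. S \<omega> \<partial>?L) = 0"
    using second_moment_iid_sum[OF O.prob_space_axioms finite_lessThan f_meas mom(1,3)]
    unfolding S_def sample_law_def by (simp_all add: mom(2) H(3))
  have "L.variance est \<ge> 1 / real n * V"
    if est: "est \<in> statistics n N" "globally_unbiased n N ll P Q \<psi> est" "finite_variance ?L est"
    for est
  proof -
    \<comment> \<open>Statistics are measurable for the Borel product; since the design law lives on
      the Borel sets, this is the sigma-algebra of the sample law.\<close>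
    have "sets ?L = sets (\<Pi>\<^sub>M i\<in>{..<n}. borel \<Otimes>\<^sub>M N)"
      unfolding sample_law_def by (intro sets_PiM_cong refl sets_obs_law[OF model design])
    then have est_meas[measurable]: "est \<in> borel_measurable ?L"
      using est(1) unfolding statistics_def by (simp cong: measurable_cong_sets)
    have est_sq: "integrable ?L (\<lambda>\<omega>. (est \<omega>)\<^sup>2)"
      using est(3) by (simp add: finite_variance_def)
    have est_int: "integrable ?L est"
      by (rule L.square_integrable_imp_integrable[OF est_meas est_sq])
    have prod_int: "integrable ?L (\<lambda>\<omega>. est \<omega> * S \<omega>)"
      by (rule integrable_mult_square_integrable[OF est_meas S_meas est_sq S_sq])
    obtain \<gamma> where "regular_submodel n N ll P Pist \<psi> gr Tst H \<gamma>"
      using submodels H(1) by blast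
    then have cov: "(\<integral>\<omega>. est \<omega> * S \<omega> \<partial>?L) = V"
      unfolding S_def using unbiased_score_covariance[OF _ truth(2) est] H(2) by simp
    define \<mu> where "\<mu> = L.expectation est"
    have c_sq: "integrable ?L (\<lambda>\<omega>. (est \<omega> - \<mu>)\<^sup>2)"
      using est_sq est_int by (simp add: power2_diff)
    \<comment> \<open>Centring the estimator leaves the covariance unchanged because
      \<open>S\<close> has mean zero.\<close>
    have c_prod: "integrable ?L (\<lambda>\<omega>. (est \<omega> - \<mu>) * S \<omega>)"
      and c_cov: "(\<integral>\<omega>. (est \<omega> - \<mu>) * S \<omega> \<partial>?L) = V"
      using prod_int S_int cov S_mean by (simp_all add: left_diff_distrib)
    \<comment> \<open>The weight \<open>1 / n\<close> is the regression coefficient of the estimator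
      on \<open>S\<close>, namely \<open>V / (n * V)\<close> when \<open>V\<close> is nonzero.
      Fixing it in advance avoids division by \<open>V\<close>, so \<open>V = 0\<close> needs no
      separate case.\<close>
    have "0 \<le> (\<integral>\<omega>. ((est \<omega> - \<mu>) - S \<omega> / real n)\<^sup>2 \<partial>?L)"
      by simp
    also have "\<dots> = (\<integral>\<omega>. (est \<omega> - \<mu>)\<^sup>2 - 2 / real n * ((est \<omega> - \<mu>) * S \<omega>)
        + 1 / (real n)\<^sup>2 * (S \<omega>)\<^sup>2 \<partial>?L)"
      by (intro Bochner_Integration.integral_cong refl)
        (simp add: power2_diff power_divide)
    also have "\<dots> = L.variance est - 2 / real n * V + 1 / (real n)\<^sup>2 * (real n * V)"
      using c_sq c_prod S_sq c_cov S_var by (simp add: \<mu>_def)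
    also have "\<dots> = L.variance est - 1 / real n * V"
      using sample_size by (simp add: field_simps power2_eq_square)
    finally show ?thesis by simp
  qed
  then show ?thesis
    using mom(1,2) H(3) unfolding H_def V_def by auto
qed

end
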